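(* There exist a Boolean algebra $B$ and two ultracontacts $\mathscr K_1,\mathscr K_2$ on $B$ such that $\mathscr K_1\cap\mathscr K_2$ is not an ultracontact on $B$. (In general, the set of ultracontacts on a Boolean algebra is not closed under intersections.)
   Context: Let $B$ be a non-trivial Boolean algebra with order $\le$ and join $+$. For $F,G\subseteq B$ put $F+G=\{f+g: f\in F,\ g\in G\}$, and write $F\preceq G$ iff for every $g\in G$ there is $f\in F$ with $f\le g$. An ultracontact on $B$ is a family $\mathscr K\subseteq 2^B$ such that for all $F,G\subseteq B$: (K0) $\emptyset\notin\mathscr K$; (K1) if $0\in F$ then $F\notin\mathscr K$; (K2) if $x\neq 0$ then $\{x\}\in\mathscr K$; (K3) if $F\preceq G$, $G\neq\emptyset$ and $F\in\mathscr K$, then $G\in\mathscr K$; (K4) if $F+G\in\mathscr K$ then $F\in\mathscr K$ or $G\in\mathscr K$. *)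

theory Defs
  imports "HOL-Algebra.Lattice"
begin

text \<open>
  Boolean algebras are carrier-based, so that one can quantify existentially over them:
  a distributive complemented bounded lattice in the sense of \<open>HOL-Algebra\<close>.
  (One distributive law suffices; its dual follows in any lattice.)
\<close>

locale boolean_lattice = bounded_lattice L for L (structure) +
  assumes meet_join_distrib:
      "\<lbrakk>x \<in> carrier L; y \<in> carrier L; z \<in> carrier L\<rbrakk>
        \<Longrightarrow> x \<sqinter> (y \<squnion> z) = (x \<sqinter> y) \<squnion> (x \<sqinter> z)"
    and complement_exists:
      "x \<in> carrier L \<Longrightarrow> \<exists>y\<in>carrier L. x \<squnion> y = \<top> \<and> x \<sqinter> y = \<bottom>"

locale nontrivial_boolean_lattice = boolean_lattice +
  assumes bottom_neq_top: "\<bottom> \<noteq> \<top>"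

definition set_join :: "('a, 'b) gorder_scheme \<Rightarrow> 'a set \<Rightarrow> 'a set \<Rightarrow> 'a set" where
  "set_join L F G = {f \<squnion>\<^bsub>L\<^esub> g | f g. f \<in> F \<and> g \<in> G}"

definition set_below :: "('a, 'b) gorder_scheme \<Rightarrow> 'a set \<Rightarrow> 'a set \<Rightarrow> bool" where
  "set_below L F G \<longleftrightarrow> (\<forall>g\<in>G. \<exists>f\<in>F. f \<sqsubseteq>\<^bsub>L\<^esub> g)"

locale ultracontact = nontrivial_boolean_lattice B for B (structure) +
  fixes K :: "'a set set"
  assumes families: "K \<subseteq> Pow (carrier B)"
    and K0: "{} \<notin> K"
    and K1: "\<lbrakk>F \<subseteq> carrier B; \<bottom> \<in> F\<rbrakk> \<Longrightarrow> F \<notin> K"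
    and K2: "\<lbrakk>x \<in> carrier B; x \<noteq> \<bottom>\<rbrakk> \<Longrightarrow> {x} \<in> K"
    and K3: "\<lbrakk>F \<subseteq> carrier B; G \<subseteq> carrier B; set_below B F G; G \<noteq> {}; F \<in> K\<rbrakk> \<Longrightarrow> G \<in> K"
    and K4: "\<lbrakk>F \<subseteq> carrier B; G \<subseteq> carrier B; set_join B F G \<in> K\<rbrakk> \<Longrightarrow> F \<in> K \<or> G \<in> K"

end

theory Submission
  imports Defs "HOL-Library.Nat_Bijection"
begin

text \<open>
  On the finite Boolean algebra of subsets of a set of atoms, every family \<open>S\<close> of atom sets
  covering all atoms induces an ultracontact: a nonempty \<open>F\<close> belongs to it iff some member of \<open>S\<close>
  meets every element of \<open>F\<close>. Take atoms \<open>a\<close>, \<open>b\<close>, \<open>c\<close> and let the two families be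
  \<open>{{a, b}, {c}}\<close> and \<open>{{a, c}, {b}}\<close>. Then \<open>{a, b}\<close> lies outside the second ultracontact and
  \<open>{a, c}\<close> outside the first, whereas \<open>{a, b} + {a, c} = {a, a + b, a + c, b + c}\<close> lies in both.
  So the intersection violates (K4).
\<close>

text \<open>Subsets of \<open>A\<close> are coded as natural numbers by their characteristic binary expansions.\<close>

definition powerset_order :: "nat set \<Rightarrow> nat gorder" where
  "powerset_order A =
    \<lparr>carrier = {x. set_decode x \<subseteq> A}, eq = (=), le = (\<lambda>x y. set_decode x \<subseteq> set_decode y)\<rparr>"

lemma carrier_powerset_order [simp]:
  "x \<in> carrier (powerset_order A) \<longleftrightarrow> set_decode x \<subseteq> A"
  by (simp add: powerset_order_def)

lemma le_powerset_order [simp]: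
  "x \<sqsubseteq>\<^bsub>powerset_order A\<^esub> y \<longleftrightarrow> set_decode x \<subseteq> set_decode y"
  by (simp add: powerset_order_def)

lemma eq_powerset_order [simp]: "x .=\<^bsub>powerset_order A\<^esub> y \<longleftrightarrow> x = y"
  by (simp add: powerset_order_def)

text \<open>Read from right to left, this turns equations between codes into equations between sets,
  where extensional reasoning applies.\<close>

lemma set_decode_eq_iff: "set_decode x = set_decode y \<longleftrightarrow> x = y"
  by (metis set_decode_inverse)

lemma partial_order_powerset_order: "partial_order (powerset_order A)"
  by unfold_locales (auto simp: powerset_order_def simp flip: set_decode_eq_iff)

lemma least_Upper_powerset_order:
  assumes "set_decode x \<subseteq> A" "set_decode y \<subseteq> A"
  shows "least (powerset_order A) (set_encode (set_decode x \<union> set_decode y))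
    (Upper (powerset_order A) {x, y})"
  using assms by (auto simp: least_def Upper_def)

lemma greatest_Lower_powerset_order:
  assumes "set_decode x \<subseteq> A" "set_decode y \<subseteq> A"
  shows "greatest (powerset_order A) (set_encode (set_decode x \<inter> set_decode y))
    (Lower (powerset_order A) {x, y})"
  using assms by (auto simp: greatest_def Lower_def)

lemma least_bottom_powerset_order: "least (powerset_order A) 0 (carrier (powerset_order A))"
  by (auto simp: least_def)

text \<open>Codes decode to finite sets only, and \<open>set_encode\<close> has the default value
  \<open>0\<close> on infinite sets, so \<open>A\<close> has to be finite for
  \<open>set_encode A\<close> to be its code.\<close>

lemma greatest_top_powerset_order:
  assumes "finite A"
  shows "greatest (powerset_order A) (set_encode A) (carrier (powerset_order A))"
  using assms by (auto simp: greatest_def)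

lemma bounded_lattice_powerset_order:
  assumes "finite A"
  shows "bounded_lattice (powerset_order A)"
proof -
  interpret partial_order "powerset_order A"
    by (rule partial_order_powerset_order)
  show ?thesis
    using least_Upper_powerset_order greatest_Lower_powerset_order
      least_bottom_powerset_order greatest_top_powerset_order[OF assms]
    by unfold_locales (simp_all only: carrier_powerset_order, blast+)
qed

context
  fixes A :: "nat set"
  assumes finite_A: "finite A"
begin

interpretation bounded_lattice "powerset_order A"
  using finite_A by (rule bounded_lattice_powerset_order)

text \<open>The operation \<squnion> chooses some least upper bound. Since such bounds are unique,
  the choice must be the code of the union.\<close>

lemma set_decode_join:
  assumes "set_decode x \<subseteq> A" "set_decode y \<subseteq> A"
  shows "set_decode (x \<squnion>\<^bsub>powerset_order A\<^esub> y) = set_decode x \<union> set_decode y"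
proof -
  have "x \<squnion>\<^bsub>powerset_order A\<^esub> y = set_encode (set_decode x \<union> set_decode y)"
    by (rule joinI)
      (use assms least_Upper_powerset_order[OF assms] in \<open>auto dest: least_unique\<close>)
  then show ?thesis by simp
qed

lemma set_decode_meet:
  assumes "set_decode x \<subseteq> A" "set_decode y \<subseteq> A"
  shows "set_decode (x \<sqinter>\<^bsub>powerset_order A\<^esub> y) = set_decode x \<inter> set_decode y"
proof -
  have "x \<sqinter>\<^bsub>powerset_order A\<^esub> y = set_encode (set_decode x \<inter> set_decode y)"
    by (rule meetI)
      (use assms greatest_Lower_powerset_order[OF assms] in \<open>auto dest: greatest_unique\<close>)
  then show ?thesis by simp
qed

lemma bottom_powerset_order: "\<bottom>\<^bsub>powerset_order A\<^esub> = 0"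
  using least_unique[OF bottom_least least_bottom_powerset_order] .

lemma top_powerset_order: "\<top>\<^bsub>powerset_order A\<^esub> = set_encode A"
  using greatest_unique[OF top_greatest greatest_top_powerset_order[OF finite_A]] .

lemma nontrivial_boolean_lattice_powerset_order:
  assumes "A \<noteq> {}"
  shows "nontrivial_boolean_lattice (powerset_order A)"
proof unfold_locales
  fix x y z
  assume "x \<in> carrier (powerset_order A)" "y \<in> carrier (powerset_order A)"
    "z \<in> carrier (powerset_order A)"
  then have sub: "set_decode x \<subseteq> A" "set_decode y \<subseteq> A" "set_decode z \<subseteq> A"
    by simp_all
  then have "set_decode x \<inter> set_decode y \<subseteq> A" "set_decode x \<inter> set_decode z \<subseteq> A"
    by auto
  with sub show "x \<sqinter>\<^bsub>powerset_order A\<^esub> (y \<squnion>\<^bsub>powerset_order A\<^esub> z) =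
      (x \<sqinter>\<^bsub>powerset_order A\<^esub> y) \<squnion>\<^bsub>powerset_order A\<^esub> (x \<sqinter>\<^bsub>powerset_order A\<^esub> z)"
    by (simp add: set_decode_join set_decode_meet Int_Un_distrib flip: set_decode_eq_iff)
next
  fix x
  assume "x \<in> carrier (powerset_order A)"
  then have x: "set_decode x \<subseteq> A" by simp
  let ?y = "set_encode (A - set_decode x)"
  have y: "set_decode ?y = A - set_decode x"
    using finite_A by simp
  have "x \<squnion>\<^bsub>powerset_order A\<^esub> ?y = \<top>\<^bsub>powerset_order A\<^esub> \<and>
      x \<sqinter>\<^bsub>powerset_order A\<^esub> ?y = \<bottom>\<^bsub>powerset_order A\<^esub>"
    using x finite_A
    by (auto simp: y set_decode_join set_decode_meet top_powerset_order bottom_powerset_order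
        simp flip: set_decode_eq_iff)
  moreover have "?y \<in> carrier (powerset_order A)"
    by (simp add: y)
  ultimately show "\<exists>y\<in>carrier (powerset_order A).
      x \<squnion>\<^bsub>powerset_order A\<^esub> y = \<top>\<^bsub>powerset_order A\<^esub> \<and>
      x \<sqinter>\<^bsub>powerset_order A\<^esub> y = \<bottom>\<^bsub>powerset_order A\<^esub>"
    by blast
next
  show "\<bottom>\<^bsub>powerset_order A\<^esub> \<noteq> \<top>\<^bsub>powerset_order A\<^esub>"
    using assms finite_A
    by (simp add: top_powerset_order bottom_powerset_order flip: set_decode_eq_iff)
qed

end

text \<open>The conjunct \<open>F \<noteq> {}\<close> secures (K0), because the quantifier over
  \<open>F\<close> is vacuous on the empty family. One \<open>s\<close> has to serve all of
  \<open>F\<close>.\<close>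

definition induced_contact :: "nat set \<Rightarrow> nat set set \<Rightarrow> nat set set" where
  "induced_contact A S = {F. F \<subseteq> carrier (powerset_order A) \<and> F \<noteq> {} \<and>
    (\<exists>s\<in>S. \<forall>f\<in>F. set_decode f \<inter> s \<noteq> {})}"

lemma induced_contact_singleton:
  assumes "A \<subseteq> \<Union>S" "set_decode x \<subseteq> A" "x \<noteq> 0"
  shows "{x} \<in> induced_contact A S"
proof -
  have "set_decode x \<noteq> {}"
    using assms(3) set_decode_eq_iff[of x 0] by simp
  then obtain i where i: "i \<in> set_decode x"
    by blast
  \<comment> \<open>The covering hypothesis on \<open>S\<close> yields (K2): an atom of a nonzero
    element lies in some member of \<open>S\<close>.\<close>
  with assms obtain s where "s \<in> S" "i \<in> s"
    by blast
  with i assms show ?thesis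
    by (auto simp: induced_contact_def)
qed

lemma induced_contact_mono:
  assumes "F \<in> induced_contact A S" "set_below (powerset_order A) F G"
    and "G \<subseteq> carrier (powerset_order A)" "G \<noteq> {}"
  shows "G \<in> induced_contact A S"
proof -
  obtain s where s: "s \<in> S" "\<And>f. f \<in> F \<Longrightarrow> set_decode f \<inter> s \<noteq> {}"
    using assms(1) by (auto simp: induced_contact_def)
  have "set_decode g \<inter> s \<noteq> {}" if g: "g \<in> G" for g
  proof -
    obtain f where "f \<in> F" "set_decode f \<subseteq> set_decode g"
      using assms(2) g by (auto simp: set_below_def)
    with s(2) show ?thesis by blast
  qed
  with s(1) assms(3,4) show ?thesis
    unfolding induced_contact_def by blast
qed

text \<open>If some \<open>f\<close> in \<open>F\<close> and some \<open>g\<close> in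
  \<open>G\<close> both missed \<open>s\<close>, then so would their join. Hence an \<open>s\<close>
  that meets all joins meets every element of \<open>F\<close> or every element of
  \<open>G\<close>.\<close>

lemma induced_contact_join:
  assumes "finite A" "F \<subseteq> carrier (powerset_order A)" "G \<subseteq> carrier (powerset_order A)"
    and "set_join (powerset_order A) F G \<in> induced_contact A S"
  shows "F \<in> induced_contact A S \<or> G \<in> induced_contact A S"
proof -
  \<comment> \<open>An empty \<open>F\<close> or \<open>G\<close> would leave no joins at all, while
    members of the induced family are nonempty.\<close>
  obtain s where ne: "F \<noteq> {}" "G \<noteq> {}" and s: "s \<in> S"
    and meets: "\<And>f g. \<lbrakk>f \<in> F; g \<in> G\<rbrakk> \<Longrightarrow> set_decode (f \<squnion>\<^bsub>powerset_order A\<^esub> g) \<inter> s \<noteq> {}"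
    using assms(4) unfolding induced_contact_def set_join_def by blast
  have "(set_decode f \<union> set_decode g) \<inter> s \<noteq> {}" if "f \<in> F" "g \<in> G" for f g
  proof -
    from assms(2,3) that have "set_decode f \<subseteq> A" "set_decode g \<subseteq> A"
      unfolding carrier_powerset_order[symmetric] by blast+
    from set_decode_join[OF assms(1) this] meets[OF that] show ?thesis
      by simp
  qed
  then have "(\<forall>f\<in>F. set_decode f \<inter> s \<noteq> {}) \<or> (\<forall>g\<in>G. set_decode g \<inter> s \<noteq> {})"
    by blast
  then show ?thesis
    unfolding induced_contact_def using assms(2,3) ne s by blast
qed

lemma ultracontact_induced_contact:
  assumes A: "finite A" "A \<noteq> {}" and cover: "A \<subseteq> \<Union>S"
  shows "ultracontact (powerset_order A) (induced_contact A S)"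
proof (intro ultracontact.intro ultracontact_axioms.intro)
  show "nontrivial_boolean_lattice (powerset_order A)"
    using A by (rule nontrivial_boolean_lattice_powerset_order)
  show "induced_contact A S \<subseteq> Pow (carrier (powerset_order A))" "{} \<notin> induced_contact A S"
    by (auto simp: induced_contact_def)
  \<comment> \<open>The bottom is \<open>0\<close>, which decodes to the empty set and so meets no
    \<open>s\<close>.\<close>
  show "F \<notin> induced_contact A S" if "\<bottom>\<^bsub>powerset_order A\<^esub> \<in> F" for F
    using that by (force simp: induced_contact_def bottom_powerset_order[OF A(1)])
  show "{x} \<in> induced_contact A S"
    if "x \<in> carrier (powerset_order A)" "x \<noteq> \<bottom>\<^bsub>powerset_order A\<^esub>" for x
    using that induced_contact_singleton[OF cover] by (simp add: bottom_powerset_order[OF A(1)])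
  show "G \<in> induced_contact A S"
    if "G \<subseteq> carrier (powerset_order A)" "set_below (powerset_order A) F G" "G \<noteq> {}"
      "F \<in> induced_contact A S" for F G
    using that by (blast intro: induced_contact_mono)
  show "F \<in> induced_contact A S \<or> G \<in> induced_contact A S"
    if "F \<subseteq> carrier (powerset_order A)" "G \<subseteq> carrier (powerset_order A)"
      "set_join (powerset_order A) F G \<in> induced_contact A S" for F G
    using A(1) that by (rule induced_contact_join)
qed

theorem theorem5p12:
  shows "\<exists>(B :: nat gorder) K\<^sub>1 K\<^sub>2.
    nontrivial_boolean_lattice B \<and>
    ultracontact B K\<^sub>1 \<and> ultracontact B K\<^sub>2 \<and>
    \<not> ultracontact B (K\<^sub>1 \<inter> K\<^sub>2)"
proof (intro exI conjI)
  \<comment> \<open>The numbers 0, 1, 2 serve as the atoms; their singletons are coded by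
    \<open>a\<close>, \<open>b\<close>, \<open>c\<close> below.\<close>
  define A :: "nat set" where "A = {0, 1, 2}"
  define B where "B = powerset_order A"
  define K\<^sub>1 where "K\<^sub>1 = induced_contact A {{0, 1}, {2}}"
  define K\<^sub>2 where "K\<^sub>2 = induced_contact A {{0, 2}, {1}}"
  have A: "finite A" "A \<noteq> {}"
    by (simp_all add: A_def)
  show "nontrivial_boolean_lattice B"
    unfolding B_def using A by (rule nontrivial_boolean_lattice_powerset_order)
  show "ultracontact B K\<^sub>1" "ultracontact B K\<^sub>2"
    unfolding B_def K\<^sub>1_def K\<^sub>2_def by (rule ultracontact_induced_contact; simp add: A_def)+
  define a where "a = set_encode {0}"
  define b where "b = set_encode {1}"
  define c where "c = set_encode {2}"
  have decode: "set_decode a = {0}" "set_decode b = {1}" "set_decode c = {2}"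
    unfolding a_def b_def c_def by (rule set_encode_inverse; simp)+
  have sub: "{a, b} \<subseteq> carrier B" "{a, c} \<subseteq> carrier B"
    by (simp_all add: B_def A_def decode)
  have "set_decode (x \<squnion>\<^bsub>B\<^esub> y) = set_decode x \<union> set_decode y"
    if "x \<in> {a, b}" "y \<in> {a, c}" for x y
    unfolding B_def by (rule set_decode_join) (use that in \<open>auto simp: A_def decode\<close>)
  then have join: "set_decode (a \<squnion>\<^bsub>B\<^esub> a) = {0}" "set_decode (a \<squnion>\<^bsub>B\<^esub> c) = {2, 0}"
    "set_decode (b \<squnion>\<^bsub>B\<^esub> a) = {0, 1}" "set_decode (b \<squnion>\<^bsub>B\<^esub> c) = {2, 1}"
    by (simp_all add: decode)
  have set_join: "set_join B {a, b} {a, c} = {a \<squnion>\<^bsub>B\<^esub> a, a \<squnion>\<^bsub>B\<^esub> c, b \<squnion>\<^bsub>B\<^esub> a, b \<squnion>\<^bsub>B\<^esub> c}"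
    unfolding set_join_def by blast
  \<comment> \<open>The deleted simplification rules express membership in decoded sets by parity
    and halving of the code; without them the explicit sets in \<open>join\<close> are used.\<close>
  have "set_join B {a, b} {a, c} \<subseteq> carrier (powerset_order A)"
    unfolding set_join by (simp add: join A_def del: set_decode_0 set_decode_Suc)
  \<comment> \<open>The witnesses are \<open>{0, 1}\<close> for \<open>K\<^sub>1\<close> and
    \<open>{0, 2}\<close> for \<open>K\<^sub>2\<close>: three of the joins contain 0, and the
    fourth, \<open>{2, 1}\<close>, meets both sets.\<close>
  then have "set_join B {a, b} {a, c} \<in> K\<^sub>1 \<inter> K\<^sub>2"
    unfolding set_join K\<^sub>1_def K\<^sub>2_def induced_contact_def
    by (simp add: join del: set_decode_0 set_decode_Suc)
  \<comment> \<open>For \<open>K\<^sub>2\<close>, \<open>b\<close> misses \<open>{0, 2}\<close> and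
    \<open>a\<close> misses \<open>{1}\<close>; for \<open>K\<^sub>1\<close>, \<open>c\<close>
    misses \<open>{0, 1}\<close> and \<open>a\<close> misses \<open>{2}\<close>.\<close>
  moreover have "{a, b} \<notin> K\<^sub>2" "{a, c} \<notin> K\<^sub>1"
    by (simp_all add: K\<^sub>1_def K\<^sub>2_def induced_contact_def decode del: set_decode_0 set_decode_Suc)
  ultimately show "\<not> ultracontact B (K\<^sub>1 \<inter> K\<^sub>2)"
    using sub ultracontact.K4[of B "K\<^sub>1 \<inter> K\<^sub>2" "{a, b}" "{a, c}"] by blast
qed

end
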